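(* Let $a,b,c$ be positive integers with $\Delta:=a^2b^2+4abc\neq0$, let $w_0,w_1$ be arbitrary, and let $\{w_n\}$ be defined by $w_n=aw_{n-1}+cw_{n-2}$ for $n\ge2$ even and $w_n=bw_{n-1}+cw_{n-2}$ for $n\ge 2$ odd. Let $\{u_n\}$ be the sequence with the same recurrence and $u_0=0,u_1=1$. Then for any nonnegative integers $n,r,m$ with $m>1$, $$w_{mn+r}=\frac{a^{1-\xi(mn+r)}}{(ab)^{\lfloor \frac{mn+r}{2}\rfloor}}\sum_{i=0}^{n}\binom{n}{i}c^{n-i}u_m^{i}u_{m-1}^{n-i}w_{i+r}\,\delta[m,n,r,i],$$ where $\delta[m,n,r,i]:=(ab)^{\lfloor\frac{i+r}{2}\rfloor+n\lfloor\frac m2\rfloor}a^{-\xi(m+1)i-1+\xi(i+r)}b^{\xi(m)(n-i)}$.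
   Context: $\xi(n)=n-2\lfloor n/2\rfloor$ is the parity function. $\{u_n\}$ is the generalized bi-periodic Fibonacci sequence. *)

theory Defs
  imports Complex_Main
begin

definition parity :: "nat \<Rightarrow> int" where
  "parity n = int n - 2 * int (n div 2)"

definition biperiodic :: "int \<Rightarrow> int \<Rightarrow> int \<Rightarrow> (nat \<Rightarrow> complex) \<Rightarrow> bool" where
  "biperiodic a b c w \<longleftrightarrow>
     (\<forall>n\<ge>2. w n = (if even n then of_int a else of_int b) * w (n - 1) + of_int c * w (n - 2))"

(* The exponent of a can be negative, hence integer powers; the exponent of b
   is a nonnegative integer whenever i <= n. *)
definition delta :: "int \<Rightarrow> int \<Rightarrow> nat \<Rightarrow> nat \<Rightarrow> nat \<Rightarrow> nat \<Rightarrow> complex" where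
  "delta a b m n r i =
     (of_int a * of_int b) ^ ((i + r) div 2 + n * (m div 2))
     * of_int a powi (- parity (m + 1) * int i - 1 + parity (i + r))
     * of_int b powi (parity m * (int n - int i))"

end

theory Submission
  imports Defs
begin

text \<open>
  The rescaled sequence \<open>W k = w k * (a b)^(k div 2) * a powi (parity k - 1)\<close> satisfies the single
  recurrence \<open>W (k + 2) = a b * W (k + 1) + a b c * W k\<close> regardless of the parity of \<open>k\<close>. If \<open>U\<close>
  is \<open>u\<close> rescaled in the same way, then \<open>W (m + s) = U m * W (s + 1) + a b c * U (m - 1) * W s\<close>.
  Advancing the index by \<open>m\<close> thus acts as \<open>x E + y\<close> with \<open>E\<close> the shift, \<open>x = U m\<close> and
  \<open>y = a b c * U (m - 1)\<close>, and the claim is the binomial expansion of \<open>(x E + y)^n\<close>.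
\<close>

text \<open>Induction on \<open>n\<close> with \<open>r\<close> free, because the step evaluates
  \<open>f n\<close> at \<open>Suc r\<close> as well; Pascal's rule merges the two resulting
  sums.\<close>

lemma shift_binomial:
  fixes x y :: "'a::comm_semiring_1"
  assumes step: "\<And>n r. f (Suc n) r = x * f n (Suc r) + y * f n r"
  shows "f n r = (\<Sum>i\<le>n. of_nat (n choose i) * x ^ i * y ^ (n - i) * f 0 (i + r))"
proof (induction n arbitrary: r)
  case 0
  show ?case by simp
next
  case (Suc n)
  let ?t = "\<lambda>i. x ^ i * y ^ (Suc n - i) * f 0 (i + r)"
  have 1: "x * f n (Suc r) = (\<Sum>i\<le>n. of_nat (n choose i) * ?t (Suc i))"
    by (simp add: Suc.IH[of "Suc r"] sum_distrib_left mult_ac)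
  have 2: "y * f n r = (\<Sum>i\<le>n. of_nat (n choose i) * ?t i)"
    unfolding Suc.IH[of r] sum_distrib_left
    by (rule sum.cong) (simp_all add: Suc_diff_le mult_ac)
  \<comment> \<open>The added term vanishes, as \<open>n choose Suc n\<close> is 0. Splitting off
    \<open>?t 0\<close> then leaves a sum aligned with the one in \<open>1\<close>.\<close>
  also have "\<dots> = (\<Sum>i\<le>Suc n. of_nat (n choose i) * ?t i)"
    by (simp add: binomial_eq_0)
  also have "\<dots> = ?t 0 + (\<Sum>i\<le>n. of_nat (n choose Suc i) * ?t (Suc i))"
    by (subst sum.atMost_Suc_shift) simp
  finally have "f (Suc n) r
      = ?t 0 + (\<Sum>i\<le>n. of_nat (Suc n choose Suc i) * ?t (Suc i))"
    unfolding step 1 by (simp add: sum.distrib distrib_right add_ac)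
  also have "\<dots> = (\<Sum>i\<le>Suc n. of_nat (Suc n choose i) * ?t i)"
    by (simp add: sum.atMost_Suc_shift del: sum.atMost_Suc binomial_Suc_Suc)
  finally show ?case by (simp only: mult.assoc)
qed

text \<open>As functions of \<open>m\<close>, both sides satisfy the same second-order recurrence,
  so agreement at 0 and 1 suffices.\<close>

lemma linear_recurrence_add:
  fixes P Q :: "'a::comm_semiring_1"
  assumes W: "\<And>k. W (Suc (Suc k)) = P * W (Suc k) + Q * W k"
    and U: "\<And>k. U (Suc (Suc k)) = P * U (Suc k) + Q * U k"
    and "U 0 = 0" and "U (Suc 0) = 1"
  shows "W (Suc m + s) = U (Suc m) * W (Suc s) + Q * U m * W s"
proof (induction m rule: induct_nat_012)
  case (ge2 k)
  have "W (Suc (Suc (Suc k)) + s) = P * W (Suc (Suc k) + s) + Q * W (Suc k + s)"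
    using W by simp
  then show ?case
    unfolding ge2.IH U[of "Suc k"] U[of k] by (simp add: algebra_simps)
qed (use assms in \<open>simp_all add: algebra_simps\<close>)

text \<open>The weight gains a factor \<open>A\<close> from even to odd index and \<open>B\<close>
  from odd to even, complementing the alternating coefficient to \<open>A * B\<close>. It is 1 at
  index 1, so \<open>u 1 = 1\<close> is preserved.\<close>

definition rescale :: "complex \<Rightarrow> complex \<Rightarrow> (nat \<Rightarrow> complex) \<Rightarrow> nat \<Rightarrow> complex" where
  "rescale A B w k = w k * (A * B) ^ (k div 2) * (if even k then inverse A else 1)"

lemma parity_eq_if: "parity k = (if even k then 0 else 1)"
  unfolding parity_def by (auto elim!: evenE oddE)

lemma rescale_recurrence:
  assumes "biperiodic a b c w" and "a \<noteq> 0"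
  defines "A \<equiv> of_int a" and "B \<equiv> of_int b"
  shows "rescale A B w (Suc (Suc k))
    = A * B * rescale A B w (Suc k) + A * B * of_int c * rescale A B w k"
proof -
  have "w (Suc (Suc k)) = (if even k then A else B) * w (Suc k) + of_int c * w k"
    using assms(1) unfolding biperiodic_def A_def B_def by (auto dest: spec[of _ "Suc (Suc k)"])
  moreover have "A \<noteq> 0" using \<open>a \<noteq> 0\<close> by (simp add: A_def)
  ultimately show ?thesis
    by (auto simp: rescale_def field_simps elim!: evenE oddE)
qed

lemma rescale_eq_powi:
  assumes "A \<noteq> 0"
  shows "rescale A B w k = w k * (A * B) ^ (k div 2) * A powi (parity k - 1)"
  by (simp add: rescale_def parity_eq_if power_int_minus)

text \<open>For odd \<open>m\<close>, \<open>inverse A\<close> cancels and leaves the extra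
  \<open>B\<close>; for even \<open>m\<close>, \<open>A * B\<close> makes up for
  \<open>(m - 1) div 2\<close> being one less than \<open>m div 2\<close>. This produces the power
  of \<open>b\<close> in \<open>delta\<close>.\<close>

lemma mult_rescale_pred:
  assumes "A \<noteq> 0" and "m > 0"
  shows "A * B * rescale A B u (m - 1) = u (m - 1) * (A * B) ^ (m div 2) * B powi parity m"
proof -
  obtain k where "m = Suc k" using \<open>m > 0\<close> gr0_implies_Suc by blast
  then show ?thesis
    using \<open>A \<noteq> 0\<close> by (auto simp: rescale_def parity_eq_if field_simps elim!: evenE oddE)
qed

theorem theorem2:
  fixes a b c :: int and w u :: "nat \<Rightarrow> complex" and n r m :: nat
  assumes "a > 0" and "b > 0" and "c > 0"
    and "a\<^sup>2 * b\<^sup>2 + 4 * a * b * c \<noteq> 0"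
    and "biperiodic a b c w"
    and "biperiodic a b c u" and "u 0 = 0" and "u 1 = 1"
    and "m > 1"
  shows "w (m * n + r) =
    of_int a powi (1 - parity (m * n + r)) / (of_int a * of_int b) ^ ((m * n + r) div 2)
    * (\<Sum>i=0..n. of_nat (n choose i) * of_int c ^ (n - i) * u m ^ i * u (m - 1) ^ (n - i)
          * w (i + r) * delta a b m n r i)"
proof -
  define A B C :: complex where "A = of_int a" and "B = of_int b" and "C = of_int c"
  have nz: "A \<noteq> 0" "B \<noteq> 0" using assms(1,2) by (auto simp: A_def B_def)
  define W U where "W = rescale A B w" and "U = rescale A B u"
  have Wrec: "W (Suc (Suc k)) = A * B * W (Suc k) + A * B * C * W k"
    and Urec: "U (Suc (Suc k)) = A * B * U (Suc k) + A * B * C * U k" for k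
    using assms(1,5,6) rescale_recurrence by (simp_all add: W_def U_def A_def B_def C_def)
  have U01: "U 0 = 0" "U (Suc 0) = 1"
    using assms(7,8) by (simp_all add: U_def rescale_def)
  let ?x = "U m" and ?y = "A * B * C * U (m - 1)"
  have add: "W (m + s) = ?x * W (Suc s) + ?y * W s" for s
    using linear_recurrence_add[of W "A * B" "A * B * C" U, OF Wrec Urec U01, of "m - 1" s] \<open>m > 1\<close> by simp
  \<comment> \<open>The step hypothesis is \<open>add\<close> at
    \<open>s = m * n + r\<close>.\<close>
  have expansion: "W (m * n + r) = (\<Sum>i\<le>n. of_nat (n choose i) * ?x ^ i * ?y ^ (n - i) * W (i + r))"
    using shift_binomial[of "\<lambda>n r. W (m * n + r)" ?x ?y n r] add
    by (simp add: add.assoc)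
  \<comment> \<open>Here \<open>parity m - 1 = - parity (m + 1)\<close>.\<close>
  have x: "?x = u m * (A * B) ^ (m div 2) * A powi (- parity (m + 1))"
    unfolding U_def rescale_eq_powi[OF nz(1)] by (simp add: parity_eq_if)
  have y: "?y = C * (u (m - 1) * (A * B) ^ (m div 2) * B powi parity m)"
    using mult_rescale_pred[OF nz(1), of m B u] \<open>m > 1\<close> by (simp add: U_def mult_ac)
  \<comment> \<open>Writing \<open>n = i + (n - i)\<close> splits \<open>delta\<close> into the
    weights carried by \<open>?x ^ i\<close>, \<open>?y ^ (n - i)\<close> and
    \<open>W (i + r)\<close>.\<close>
  have summand: "of_nat (n choose i) * ?x ^ i * ?y ^ (n - i) * W (i + r)
      = of_nat (n choose i) * C ^ (n - i) * u m ^ i * u (m - 1) ^ (n - i)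
          * w (i + r) * delta a b m n r i" if "i \<le> n" for i
  proof -
    have "(A * B) ^ ((i + r) div 2 + n * (m div 2))
        = (A * B) ^ ((i + r) div 2) * ((A * B) ^ (m div 2)) ^ i * ((A * B) ^ (m div 2)) ^ (n - i)"
    proof -
      have "n * (m div 2) = m div 2 * i + m div 2 * (n - i)"
        using that by (metis add_mult_distrib2 le_add_diff_inverse mult.commute)
      then show ?thesis by (simp only: power_add power_mult mult.assoc)
    qed
    moreover have "A powi (- parity (m + 1) * int i - 1 + parity (i + r))
        = (A powi (- parity (m + 1))) ^ i * A powi (parity (i + r) - 1)"
    proof -
      have "- parity (m + 1) * int i - 1 + parity (i + r)
          = - parity (m + 1) * int i + (parity (i + r) - 1)" by simp
      then show ?thesis
        by (simp only: power_int_add[OF disjI1[OF nz(1)]] power_int_mult power_int_of_nat)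
    qed
    moreover have "B powi (parity m * (int n - int i)) = (B powi parity m) ^ (n - i)"
      using that by (simp add: power_int_mult flip: of_nat_diff)
    ultimately have "delta a b m n r i
        = (A * B) ^ ((i + r) div 2) * ((A * B) ^ (m div 2)) ^ i * ((A * B) ^ (m div 2)) ^ (n - i)
          * ((A powi (- parity (m + 1))) ^ i * A powi (parity (i + r) - 1))
          * (B powi parity m) ^ (n - i)"
      by (simp only: delta_def A_def[symmetric] B_def[symmetric])
    then show ?thesis
      unfolding x y W_def rescale_eq_powi[OF nz(1)] by (simp only: power_mult_distrib mult_ac)
  qed
  \<comment> \<open>Undoing the rescaling gives the prefactor of the claim.\<close>
  have "w k = A powi (1 - parity k) / (A * B) ^ (k div 2) * W k" for k
    using nz by (simp add: W_def rescale_def parity_eq_if)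
  then have "w (m * n + r) = A powi (1 - parity (m * n + r)) / (A * B) ^ ((m * n + r) div 2)
      * W (m * n + r)" .
  also have "W (m * n + r) = (\<Sum>i=0..n. of_nat (n choose i) * C ^ (n - i) * u m ^ i
      * u (m - 1) ^ (n - i) * w (i + r) * delta a b m n r i)"
    unfolding expansion atLeast0AtMost by (rule sum.cong) (simp_all only: summand atMost_iff)
  finally show ?thesis unfolding A_def B_def C_def .
qed

end
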